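(* Let $\mathcal A$ be a $\mathcal B(\mathcal H,\mathcal K)$-valued frame for $\mathcal H$ with lower frame bound $\alpha$ and let $\mathcal B$ be a $\mu$-perturbation of $\mathcal A$, where $0<\mu<\sqrt{\alpha}$. Then $\mathcal B$ is an operator-valued frame for $\mathcal H$, and for each $L\in\mathcal L_{\mathcal A}$ the dual $\widetilde{\mathcal B}_L:=\widetilde{\mathcal B}(P_{\ker T_{\mathcal B}^*}T_{\widetilde{\mathcal A}(L)})$ of $\mathcal B$ is a best approximation of $\widetilde{\mathcal A}(L)$ among the duals of $\mathcal B$, i.e. $$\|T_{\widetilde{\mathcal B}_L}-T_{\widetilde{\mathcal A}(L)}\|\le\|T_{\mathcal C}-T_{\widetilde{\mathcal A}(L)}\|\quad\text{for every dual }\mathcal C\text{ of }\mathcal B,$$ and $\widetilde{\mathcal B}_L$ is a $\lambda$-perturbation of $\widetilde{\mathcal A}(L)$, where $$\lambda=\frac{\mu}{\sqrt{\alpha}-\mu}\left(\frac{1}{\sqrt{\alpha}}+\|L\|\right).$$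
   Context: $\mathcal H,\mathcal K$ are Hilbert spaces, $I\subset\mathbb N$ is a finite or countable index set, and $\mathfrak K:=\ell^2(I,\mathcal K)$ is the Hilbert space of square-summable $\mathcal K$-valued sequences. $\mathcal B(X,Y)$ denotes the bounded everywhere defined linear operators $X\to Y$, with the operator norm; $P_V$ is the orthogonal projection onto a closed subspace $V$. A sequence $\mathcal A=(A_i)_{i\in I}\subset\mathcal B(\mathcal H,\mathcal K)$ is a $\mathcal B(\mathcal H,\mathcal K)$-valued Bessel sequence if there is $\beta>0$ with $\sum_{i\in I}\|A_ix\|^2\le\beta\|x\|^2$ for all $x\in\mathcal H$. The analysis operator is $T_{\mathcal A}\in\mathcal B(\mathcal H,\mathfrak K)$, $T_{\mathcal A}x=(A_ix)_{i\in I}$, and the frame operator is $S_{\mathcal A}:=T_{\mathcal A}^*T_{\mathcal A}$. The map $\mathcal A\mapsto T_{\mathcal A}$ is a bijection from Bessel sequences onto $\mathcal B(\mathcal H,\mathfrak K)$. $\mathcal A$ is a $\mathcal B(\mathcal H,\mathcal K)$-valued (operator-valued) frame for $\mathcal H$ with lower and upper frame bounds $\alpha,\beta>0$ if $\overline{\operatorname{span}}\{\operatorname{ran}A_i^*:i\in I\}=\mathcal H$ and $\alpha\|x\|^2\le\sum_{i\in I}\|A_ix\|^2\le\beta\|x\|^2$ for all $x\in\mathcal H$; then $S_{\mathcal A}$ is boundedly invertible. A dual of an operator-valued frame $\mathcal A$ for $\mathcal H$ is a $\mathcal B(\mathcal H,\mathcal K)$-valued Bessel sequence $\widetilde{\mathcal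 A}=(\widetilde A_i)_{i\in I}$ with $\sum_{i\in I}\widetilde A_i^*A_ix=x$ for all $x\in\mathcal H$, i.e. $T_{\widetilde{\mathcal A}}^*T_{\mathcal A}=I$. Put $\mathcal L_{\mathcal A}:=\{L\in\mathcal B(\mathcal H,\mathfrak K): T_{\mathcal A}^*L=0\}$. For $L\in\mathcal L_{\mathcal A}$, $\widetilde{\mathcal A}(L)$ denotes the dual of $\mathcal A$ with analysis operator $T_{\widetilde{\mathcal A}(L)}=T_{\mathcal A}S_{\mathcal A}^{-1}+L$. The same notation is used for $\mathcal B$. For $\mu>0$, a $\mathcal B(\mathcal H,\mathcal K)$-valued Bessel sequence $\mathcal B$ is a $\mu$-perturbation of the $\mathcal B(\mathcal H,\mathcal K)$-valued Bessel sequence $\mathcal A$ if $\|T_{\mathcal A}-T_{\mathcal B}\|\le\mu$. *)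

theory Defs
  imports "HOL-Analysis.Analysis"
begin

section \<open>Scalars: the real or the complex numbers\<close>

text \<open>
  Up to isomorphism the only instances are the real numbers with trivial conjugation and the
  complex numbers: by the last axiom and additivity, \<open>x + conjugate x\<close> and \<open>x * conjugate x\<close> are
  real, so every element is a root of a quadratic polynomial with real coefficients.
\<close>

class rc_field = real_normed_field + banach +
  fixes conjugate :: "'a \<Rightarrow> 'a"
  assumes conjugate_add: "conjugate (x + y) = conjugate x + conjugate y"
    and conjugate_mult: "conjugate (x * y) = conjugate x * conjugate y"
    and mult_conjugate: "x * conjugate x = (norm x)\<^sup>2 *\<^sub>R 1"

instantiation real :: rc_field
begin
definition conjugate_real :: "real \<Rightarrow> real" where "conjugate_real x = x"
instance by standard (auto simp: conjugate_real_def power2_eq_square)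
end

instantiation complex :: rc_field
begin
definition conjugate_complex :: "complex \<Rightarrow> complex" where "conjugate_complex = cnj"
instance
  by standard (simp_all add: conjugate_complex_def scaleR_conv_of_real complex_norm_square
      del: of_real_power)
end


section \<open>Hilbert spaces over the scalar field\<close>

text \<open>
  The vectors form a complete real normed type; the record carries the scalar multiplication and
  the scalar-valued inner product (linear in the first argument) inducing the norm of the type.
\<close>

record ('f, 'a) hilbert =
  scl :: "'f \<Rightarrow> 'a \<Rightarrow> 'a"
  ip :: "'a \<Rightarrow> 'a \<Rightarrow> 'f"

locale hilbert_space = vector_space "scl H"
  for H :: "('f::rc_field, 'a::banach) hilbert" +
  assumes scl_of_real: "scl H (of_real r) x = r *\<^sub>R x"
    and ip_add: "ip H (x + y) z = ip H x z + ip H y z"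
    and ip_scl: "ip H (scl H c x) y = c * ip H x y"
    and ip_conjugate: "ip H y x = conjugate (ip H x y)"
    and ip_self: "ip H x x = of_real ((norm x)\<^sup>2)"

text \<open>Real-linearity and boundedness are part of the type of \<open>T\<close>.\<close>

definition bops :: "('f, 'a::real_normed_vector) hilbert \<Rightarrow> ('f, 'b::real_normed_vector) hilbert
    \<Rightarrow> ('a \<Rightarrow>\<^sub>L 'b) set" where
  "bops X Y = {T :: 'a \<Rightarrow>\<^sub>L 'b. \<forall>c x. T (scl X c x) = scl Y c (T x)}"

definition adj :: "('f, 'a::real_normed_vector) hilbert \<Rightarrow> ('f, 'b::real_normed_vector) hilbert
    \<Rightarrow> ('a \<Rightarrow>\<^sub>L 'b) \<Rightarrow> ('b \<Rightarrow>\<^sub>L 'a)" where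
  "adj X Y T = Blinfun (\<lambda>y. THE z. \<forall>x. ip Y (T x) y = ip X x z)"

definition orth_proj :: "('f::zero, 'a::real_normed_vector) hilbert \<Rightarrow> 'a set \<Rightarrow> ('a \<Rightarrow>\<^sub>L 'a)" where
  "orth_proj X V = Blinfun (\<lambda>x. THE p. p \<in> V \<and> (\<forall>v\<in>V. ip X (x - p) v = 0))"

definition blinfun_inv :: "('a::real_normed_vector \<Rightarrow>\<^sub>L 'b::real_normed_vector) \<Rightarrow> ('b \<Rightarrow>\<^sub>L 'a)" where
  "blinfun_inv T = Blinfun (inv (blinfun_apply T))"


section \<open>Square-summable sequences\<close>

typedef (overloaded) ('k::real_normed_vector) ell2 =
  "{f :: nat \<Rightarrow> 'k. (\<lambda>i. (norm (f i))\<^sup>2) summable_on UNIV}"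
  morphisms seq Abs_ell2
  by (rule exI[of _ "\<lambda>_. 0"]) simp

setup_lifting type_definition_ell2

lemma sq_summable_add:
  fixes f g :: "nat \<Rightarrow> 'k::real_normed_vector"
  assumes f: "(\<lambda>i. (norm (f i))\<^sup>2) summable_on UNIV" and g: "(\<lambda>i. (norm (g i))\<^sup>2) summable_on UNIV"
  shows "(\<lambda>i. (norm (f i + g i))\<^sup>2) summable_on UNIV"
    and "sqrt (\<Sum>\<^sub>\<infinity>i. (norm (f i + g i))\<^sup>2)
      \<le> sqrt (\<Sum>\<^sub>\<infinity>i. (norm (f i))\<^sup>2) + sqrt (\<Sum>\<^sub>\<infinity>i. (norm (g i))\<^sup>2)"
proof -
  let ?c = "sqrt (\<Sum>\<^sub>\<infinity>i. (norm (f i))\<^sup>2) + sqrt (\<Sum>\<^sub>\<infinity>i. (norm (g i))\<^sup>2)"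
  have le: "L2_set (\<lambda>i. norm (h i)) F \<le> sqrt (\<Sum>\<^sub>\<infinity>i. (norm (h i))\<^sup>2)"
    if "(\<lambda>i. (norm (h i))\<^sup>2) summable_on UNIV" "finite F" for F and h :: "nat \<Rightarrow> 'k"
    unfolding L2_set_def using that by (auto intro!: finite_sum_le_infsum)
  have fin: "(\<Sum>i\<in>F. (norm (f i + g i))\<^sup>2) \<le> ?c\<^sup>2" if F: "finite F" for F
  proof -
    have "L2_set (\<lambda>i. norm (f i + g i)) F \<le> L2_set (\<lambda>i. norm (f i) + norm (g i)) F"
      by (intro L2_set_mono) (auto intro: norm_triangle_ineq)
    also have "\<dots> \<le> L2_set (\<lambda>i. norm (f i)) F + L2_set (\<lambda>i. norm (g i)) F"
      by (rule L2_set_triangle_ineq)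
    also have "\<dots> \<le> ?c" using le[OF f F] le[OF g F] by linarith
    finally have "(L2_set (\<lambda>i. norm (f i + g i)) F)\<^sup>2 \<le> ?c\<^sup>2"
      by (intro power_mono) auto
    then show ?thesis by (simp add: L2_set_def sum_nonneg)
  qed
  show s: "(\<lambda>i. (norm (f i + g i))\<^sup>2) summable_on UNIV"
    by (rule nonneg_bounded_partial_sums_imp_summable_on[where C = "?c\<^sup>2"])
       (auto simp: fin intro!: eventually_finite_subsets_at_top_weakI)
  have "(\<Sum>\<^sub>\<infinity>i. (norm (f i + g i))\<^sup>2) \<le> ?c\<^sup>2"
    by (rule infsum_le_finite_sums[OF s]) (rule fin)
  moreover have "0 \<le> ?c" by (simp add: infsum_nonneg)
  ultimately show "sqrt (\<Sum>\<^sub>\<infinity>i. (norm (f i + g i))\<^sup>2) \<le> ?c"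
    by (rule real_le_lsqrt[rotated])
qed

instantiation ell2 :: (real_normed_vector) real_normed_vector
begin

lift_definition zero_ell2 :: "'a ell2" is "\<lambda>_. 0" by simp
lift_definition uminus_ell2 :: "'a ell2 \<Rightarrow> 'a ell2" is "\<lambda>f i. - f i" by simp
lift_definition plus_ell2 :: "'a ell2 \<Rightarrow> 'a ell2 \<Rightarrow> 'a ell2" is "\<lambda>f g i. f i + g i"
  by (rule sq_summable_add)
lift_definition minus_ell2 :: "'a ell2 \<Rightarrow> 'a ell2 \<Rightarrow> 'a ell2" is "\<lambda>f g i. f i - g i"
  subgoal for f g using sq_summable_add(1)[of f "\<lambda>i. - g i"] by simp
  done
lift_definition scaleR_ell2 :: "real \<Rightarrow> 'a ell2 \<Rightarrow> 'a ell2" is "\<lambda>r f i. r *\<^sub>R f i"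
  by (auto simp: power_mult_distrib intro: summable_on_cmult_right)
lift_definition norm_ell2 :: "'a ell2 \<Rightarrow> real" is "\<lambda>f. sqrt (\<Sum>\<^sub>\<infinity>i. (norm (f i))\<^sup>2)" .
definition dist_ell2 :: "'a ell2 \<Rightarrow> 'a ell2 \<Rightarrow> real" where "dist_ell2 x y = norm (x - y)"
definition sgn_ell2 :: "'a ell2 \<Rightarrow> 'a ell2" where "sgn_ell2 x = inverse (norm x) *\<^sub>R x"
definition uniformity_ell2 :: "('a ell2 \<times> 'a ell2) filter" where
  "uniformity_ell2 = (INF e\<in>{0<..}. principal {(x, y). dist x y < e})"
definition open_ell2 :: "'a ell2 set \<Rightarrow> bool" where
  "open_ell2 U \<longleftrightarrow> (\<forall>x\<in>U. \<forall>\<^sub>F (x', y) in uniformity. x' = x \<longrightarrow> y \<in> U)"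

instance
proof
  fix x y :: "'a ell2" and r :: real
  show "norm x = 0 \<longleftrightarrow> x = 0"
  proof transfer
    fix f :: "nat \<Rightarrow> 'a" assume f: "(\<lambda>i. (norm (f i))\<^sup>2) summable_on UNIV"
    have "f i = 0" if "(\<Sum>\<^sub>\<infinity>i. (norm (f i))\<^sup>2) = 0" for i
      using nonneg_infsum_le_0D[of "\<lambda>i. (norm (f i))\<^sup>2" UNIV i] f that by simp
    then show "sqrt (\<Sum>\<^sub>\<infinity>i. (norm (f i))\<^sup>2) = 0 \<longleftrightarrow> f = (\<lambda>_. 0)" by auto
  qed
  show "norm (x + y) \<le> norm x + norm y" by transfer (rule sq_summable_add)
  show "norm (r *\<^sub>R x) = \<bar>r\<bar> * norm x"
    by transfer (simp add: power_mult_distrib infsum_cmult_right' real_sqrt_mult)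
qed (rule dist_ell2_def sgn_ell2_def uniformity_ell2_def open_ell2_def
     | (transfer, simp add: algebra_simps))+

end

text \<open>\<open>\<ell>\<^sup>2(I, K)\<close> is the subspace \<open>ell2_on I\<close> of \<open>\<ell>\<^sup>2(\<nat>, K)\<close>, sequences being extended by zero.\<close>

definition ell2 :: "('f::{comm_monoid_add, t2_space}, 'k::real_normed_vector) hilbert \<Rightarrow> ('f, 'k ell2) hilbert"
  where "ell2 K = \<lparr>scl = (\<lambda>c f. Abs_ell2 (\<lambda>i. scl K c (seq f i))),
                   ip = (\<lambda>f g. \<Sum>\<^sub>\<infinity>i. ip K (seq f i) (seq g i))\<rparr>"

definition ell2_on :: "nat set \<Rightarrow> 'k::real_normed_vector ell2 set" where
  "ell2_on I = {f. \<forall>i. i \<notin> I \<longrightarrow> seq f i = 0}"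


section \<open>Operator-valued Bessel sequences and frames\<close>

text \<open>Families over \<open>I\<close> are total functions on \<open>nat\<close> whose values outside \<open>I\<close> are never used.\<close>

type_synonym ('h, 'k) opseq = "nat \<Rightarrow> 'h \<Rightarrow>\<^sub>L 'k"

definition bessel_seq :: "('f, 'h::real_normed_vector) hilbert \<Rightarrow> ('f, 'k::real_normed_vector) hilbert
    \<Rightarrow> nat set \<Rightarrow> ('h, 'k) opseq \<Rightarrow> bool" where
  "bessel_seq H K I A \<longleftrightarrow> (\<forall>i\<in>I. A i \<in> bops H K) \<and>
     (\<exists>\<beta>>0. \<forall>x. (\<lambda>i. (norm (A i x))\<^sup>2) summable_on I \<and>
                (\<Sum>\<^sub>\<infinity>i\<in>I. (norm (A i x))\<^sup>2) \<le> \<beta> * (norm x)\<^sup>2)"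

definition analysis_op :: "nat set \<Rightarrow> ('h::real_normed_vector, 'k::real_normed_vector) opseq
    \<Rightarrow> ('h \<Rightarrow>\<^sub>L 'k ell2)" where
  "analysis_op I A = Blinfun (\<lambda>x. Abs_ell2 (\<lambda>i. if i \<in> I then A i x else 0))"

lemma bessel_seq_analysis_op:
  assumes A: "bessel_seq H K I A"
  shows "seq (analysis_op I A x) i = (if i \<in> I then A i x else 0)"
proof -
  obtain b where b: "b > 0" and s: "\<And>x. (\<lambda>i. (norm (A i x))\<^sup>2) summable_on I"
    and le: "\<And>x. (\<Sum>\<^sub>\<infinity>i\<in>I. (norm (A i x))\<^sup>2) \<le> b * (norm x)\<^sup>2"
    using A by (auto simp: bessel_seq_def)
  let ?f = "\<lambda>x i. if i \<in> I then A i x else 0"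
  have "(\<lambda>i. (norm (?f x i))\<^sup>2) summable_on UNIV" for x
    using s[of x] by (rule summable_on_cong_neutral[THEN iffD1, rotated 3]) auto
  then have seq: "seq (Abs_ell2 (?f x)) = ?f x" for x
    by (simp add: Abs_ell2_inverse)
  have "bounded_linear (\<lambda>x. Abs_ell2 (?f x))"
  proof (rule bounded_linear_intro[where K = "sqrt b"])
    fix x y and r :: real
    show "Abs_ell2 (?f (x + y)) = Abs_ell2 (?f x) + Abs_ell2 (?f y)"
      by (auto simp: seq_inject[symmetric] plus_ell2.rep_eq seq blinfun.add_right)
    show "Abs_ell2 (?f (r *\<^sub>R x)) = r *\<^sub>R Abs_ell2 (?f x)"
      by (auto simp: seq_inject[symmetric] scaleR_ell2.rep_eq seq blinfun.scaleR_right)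
    have "(\<Sum>\<^sub>\<infinity>i. (norm (?f x i))\<^sup>2) = (\<Sum>\<^sub>\<infinity>i\<in>I. (norm (A i x))\<^sup>2)"
      by (rule infsum_cong_neutral) auto
    then have "norm (Abs_ell2 (?f x)) \<le> sqrt (b * (norm x)\<^sup>2)"
      using le[of x] by (simp add: norm_ell2.rep_eq seq)
    then show "norm (Abs_ell2 (?f x)) \<le> norm x * sqrt b"
      by (simp add: real_sqrt_mult mult.commute)
  qed
  then show ?thesis
    by (simp add: analysis_op_def bounded_linear_Blinfun_apply seq)
qed

text \<open>The inverse of \<open>A \<mapsto> T\<^sub>A\<close>.\<close>

definition opseq_of :: "('h::real_normed_vector \<Rightarrow>\<^sub>L 'k::real_normed_vector ell2) \<Rightarrow> ('h, 'k) opseq" where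
  "opseq_of T = (\<lambda>i. Blinfun (\<lambda>x. seq (T x) i))"

lemma opseq_of_apply:
  fixes T :: "'h::real_normed_vector \<Rightarrow>\<^sub>L 'k::real_normed_vector ell2"
  shows "opseq_of T i x = seq (T x) i"
proof -
  have "norm (seq f i) \<le> norm f" for f :: "'k ell2"
  proof -
    have "(\<Sum>j\<in>{i}. (norm (seq f j))\<^sup>2) \<le> (\<Sum>\<^sub>\<infinity>j. (norm (seq f j))\<^sup>2)"
      using seq[of f] by (intro finite_sum_le_infsum) auto
    then show ?thesis by (simp add: norm_ell2.rep_eq real_le_rsqrt)
  qed
  then have "bounded_linear (\<lambda>f :: 'k ell2. seq f i)"
    by (intro bounded_linear_intro[where K = 1]) (auto simp: plus_ell2.rep_eq scaleR_ell2.rep_eq)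
  then have "bounded_linear (\<lambda>x. seq (T x) i)"
    by (rule bounded_linear_compose[OF _ blinfun.bounded_linear_right])
  then show ?thesis by (simp add: opseq_of_def bounded_linear_Blinfun_apply)
qed

lemma analysis_op_opseq_of:
  fixes T :: "'h::real_normed_vector \<Rightarrow>\<^sub>L 'k::real_normed_vector ell2"
  assumes "range T \<subseteq> ell2_on I"
  shows "analysis_op I (opseq_of T) = T"
proof -
  have "(\<lambda>i. if i \<in> I then opseq_of T i x else 0) = seq (T x)" for x
    using assms by (force simp: ell2_on_def opseq_of_apply)
  then show ?thesis by (simp add: analysis_op_def seq_inverse blinfun_apply_inverse)
qed

text \<open>
  \<open>T\<^sub>A\<^sup>*\<close>, taken on all of \<open>\<ell>\<^sup>2(\<nat>, K)\<close>: as \<open>T\<^sub>A\<close> maps into \<open>ell2_on I\<close>, this is the adjoint on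
  \<open>\<ell>\<^sup>2(I, K)\<close>, extended by zero to the orthogonal complement of \<open>ell2_on I\<close>.
\<close>

definition synthesis_op :: "('f::{comm_monoid_add, t2_space}, 'h::real_normed_vector) hilbert
    \<Rightarrow> ('f, 'k::real_normed_vector) hilbert \<Rightarrow> nat set \<Rightarrow> ('h, 'k) opseq \<Rightarrow> ('k ell2 \<Rightarrow>\<^sub>L 'h)" where
  "synthesis_op H K I A = adj H (ell2 K) (analysis_op I A)"

definition frame_op :: "('f::{comm_monoid_add, t2_space}, 'h::real_normed_vector) hilbert
    \<Rightarrow> ('f, 'k::real_normed_vector) hilbert \<Rightarrow> nat set \<Rightarrow> ('h, 'k) opseq \<Rightarrow> ('h \<Rightarrow>\<^sub>L 'h)" where
  "frame_op H K I A = synthesis_op H K I A o\<^sub>L analysis_op I A"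

definition op_frame_bounds :: "('f::comm_ring_1, 'h::real_normed_vector) hilbert
    \<Rightarrow> ('f, 'k::real_normed_vector) hilbert \<Rightarrow> nat set \<Rightarrow> ('h, 'k) opseq
    \<Rightarrow> real \<Rightarrow> real \<Rightarrow> bool" where
  "op_frame_bounds H K I A \<alpha> \<beta> \<longleftrightarrow> 0 < \<alpha> \<and> 0 < \<beta> \<and> (\<forall>i\<in>I. A i \<in> bops H K) \<and>
     closure (module.span (scl H) (\<Union>i\<in>I. range (adj H K (A i)))) = UNIV \<and>
     (\<forall>x. (\<lambda>i. (norm (A i x))\<^sup>2) summable_on I \<and>
          \<alpha> * (norm x)\<^sup>2 \<le> (\<Sum>\<^sub>\<infinity>i\<in>I. (norm (A i x))\<^sup>2) \<and>
          (\<Sum>\<^sub>\<infinity>i\<in>I. (norm (A i x))\<^sup>2) \<le> \<beta> * (norm x)\<^sup>2)"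

definition op_frame :: "('f::comm_ring_1, 'h::real_normed_vector) hilbert
    \<Rightarrow> ('f, 'k::real_normed_vector) hilbert \<Rightarrow> nat set \<Rightarrow> ('h, 'k) opseq \<Rightarrow> bool" where
  "op_frame H K I A \<longleftrightarrow> (\<exists>\<alpha> \<beta>. op_frame_bounds H K I A \<alpha> \<beta>)"

definition dual_of :: "('f, 'h::real_normed_vector) hilbert \<Rightarrow> ('f, 'k::real_normed_vector) hilbert
    \<Rightarrow> nat set \<Rightarrow> ('h, 'k) opseq \<Rightarrow> ('h, 'k) opseq \<Rightarrow> bool" where
  "dual_of H K I A C \<longleftrightarrow> bessel_seq H K I C \<and>
     (\<forall>x. ((\<lambda>i. adj H K (C i) (A i x)) has_sum x) I)"

text \<open>\<open>dual_params H K I A\<close> is \<open>\<L>\<^sub>A\<close>, and \<open>dual H K I A L\<close> is the sequence with analysis operator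
  \<open>T\<^sub>A S\<^sub>A\<^sup>-\<^sup>1 + L\<close>.\<close>

definition dual_params :: "('f::{comm_monoid_add, t2_space}, 'h::real_normed_vector) hilbert
    \<Rightarrow> ('f, 'k::real_normed_vector) hilbert \<Rightarrow> nat set \<Rightarrow> ('h, 'k) opseq \<Rightarrow> ('h \<Rightarrow>\<^sub>L 'k ell2) set" where
  "dual_params H K I A =
     {L \<in> bops H (ell2 K). range L \<subseteq> ell2_on I \<and> synthesis_op H K I A o\<^sub>L L = 0}"

definition dual :: "('f::{comm_monoid_add, t2_space}, 'h::real_normed_vector) hilbert
    \<Rightarrow> ('f, 'k::real_normed_vector) hilbert \<Rightarrow> nat set \<Rightarrow> ('h, 'k) opseq \<Rightarrow> ('h \<Rightarrow>\<^sub>L 'k ell2)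
    \<Rightarrow> ('h, 'k) opseq" where
  "dual H K I A L = opseq_of ((analysis_op I A o\<^sub>L blinfun_inv (frame_op H K I A)) + L)"

definition synthesis_ker :: "('f::{comm_monoid_add, t2_space}, 'h::real_normed_vector) hilbert
    \<Rightarrow> ('f, 'k::real_normed_vector) hilbert \<Rightarrow> nat set \<Rightarrow> ('h, 'k) opseq \<Rightarrow> 'k ell2 set" where
  "synthesis_ker H K I A = {f \<in> ell2_on I. synthesis_op H K I A f = 0}"

definition perturbation :: "('f, 'h::real_normed_vector) hilbert \<Rightarrow> ('f, 'k::real_normed_vector) hilbert
    \<Rightarrow> nat set \<Rightarrow> real \<Rightarrow> ('h, 'k) opseq \<Rightarrow> ('h, 'k) opseq \<Rightarrow> bool" where
  "perturbation H K I \<mu> A B \<longleftrightarrow> 0 < \<mu> \<and> bessel_seq H K I A \<and> bessel_seq H K I B \<and>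
     norm (analysis_op I A - analysis_op I B) \<le> \<mu>"

end

theory Submission
  imports Defs
begin

text \<open>
  Write \<open>T = T\<^sub>B\<close>, \<open>S = T\<^sup>* T\<close> and \<open>U = T\<^sub>A S\<^sub>A\<^sup>-\<^sup>1 + L\<close>. The perturbation bound gives
  \<open>(\<surd>\<alpha> - \<mu>) \<parallel>x\<parallel> \<le> \<parallel>T x\<parallel>\<close>, so the form \<open>\<langle>T x, T y\<rangle>\<close> is coercive and represents every bounded
  functional; hence \<open>S\<close> is invertible, \<open>B\<close> is a frame, and \<open>Q = T S\<^sup>-\<^sup>1 T\<^sup>*\<close> is the orthogonal
  projection onto the range of \<open>T\<close>. On \<open>\<ell>\<^sup>2(I, K)\<close> the projection onto \<open>ker T\<^sup>*\<close> is \<open>1 - Q\<close>, so the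
  dual \<open>D\<close> of \<open>B\<close> with parameter \<open>(1 - Q) U\<close> satisfies \<open>T\<^sub>D - U = T S\<^sup>-\<^sup>1 (1 - T\<^sup>* U)\<close>. As
  \<open>T\<^sup>* T\<^sub>C = 1\<close> for each dual \<open>C\<close> of \<open>B\<close>, this equals \<open>Q (T\<^sub>C - U)\<close>, which proves optimality; as
  \<open>T\<^sub>A\<^sup>* U = 1\<close>, it also equals \<open>T S\<^sup>-\<^sup>1 (T\<^sub>A\<^sup>* - T\<^sup>*) U\<close>, where \<open>\<parallel>T S\<^sup>-\<^sup>1\<parallel> \<le> 1 / (\<surd>\<alpha> - \<mu>)\<close> and
  \<open>\<parallel>U\<parallel> \<le> 1 / \<surd>\<alpha> + \<parallel>L\<parallel>\<close>.
\<close>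


section \<open>Real parts of scalars\<close>

lemma mult_conjugate_of_real: "x * conjugate x = of_real ((norm (x :: 'f::rc_field))\<^sup>2)"
  by (simp only: mult_conjugate scaleR_conv_of_real mult_1_right)

lemma conjugate_0: "conjugate (0 :: 'f::rc_field) = 0"
  using conjugate_add[of "0::'f" 0] by simp

lemma conjugate_of_real: "conjugate (of_real r :: 'f::rc_field) = of_real r"
proof (cases "r = 0")
  case False
  have "of_real r * conjugate (of_real r :: 'f) = of_real r * of_real r"
    by (simp only: mult_conjugate_of_real norm_of_real power2_abs) (simp add: power2_eq_square)
  with False show ?thesis by simp
qed (simp add: conjugate_0)

lemma conjugate_1: "conjugate (1 :: 'f::rc_field) = 1"
  using conjugate_of_real[of 1] by simp

lemma norm_conjugate [simp]: "norm (conjugate (x :: 'f::rc_field)) = norm x"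
proof (cases "x = 0")
  case False
  have "norm x * norm (conjugate x) = norm x * norm x"
    using arg_cong[OF mult_conjugate[of x], of norm] by (simp add: norm_mult power2_eq_square)
  with False show ?thesis by simp
qed (simp add: conjugate_0)

lemma bounded_linear_conjugate: "bounded_linear (conjugate :: 'f::rc_field \<Rightarrow> 'f)"
  by (rule bounded_linear_intro[where K = 1])
    (simp_all add: conjugate_add conjugate_mult conjugate_of_real scaleR_conv_of_real)

text \<open>Read off from the expansion of \<open>(x + 1) * conjugate (x + 1)\<close>.\<close>

definition rc_re :: "'f::rc_field \<Rightarrow> real" where
  "rc_re x = ((norm (x + 1))\<^sup>2 - (norm x)\<^sup>2 - 1) / 2"

lemma of_real_rc_re: "of_real (rc_re x) = (x + conjugate (x :: 'f::rc_field)) / 2"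
proof -
  have "(of_real ((norm (x + 1))\<^sup>2 - (norm x)\<^sup>2 - 1) :: 'f)
      = (x + 1) * conjugate (x + 1) - x * conjugate x - 1"
    by (simp only: mult_conjugate_of_real of_real_diff of_real_1)
  also have "\<dots> = x + conjugate x"
    by (simp add: conjugate_add conjugate_1 algebra_simps)
  finally show ?thesis by (simp add: rc_re_def)
qed

lemma rc_re_of_real [simp]: "rc_re (of_real r :: 'f::rc_field) = r"
proof -
  have "(of_real (rc_re (of_real r :: 'f)) :: 'f) = of_real r"
    by (simp add: of_real_rc_re conjugate_of_real)
  then show ?thesis by (simp only: of_real_eq_iff)
qed

lemma rc_re_conjugate [simp]: "rc_re (conjugate x) = rc_re (x :: 'f::rc_field)"
proof -
  have "norm (conjugate x + 1) = norm (x + 1)"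
    by (metis conjugate_add conjugate_1 norm_conjugate)
  then show ?thesis by (simp add: rc_re_def)
qed

lemma bounded_linear_rc_re: "bounded_linear (rc_re :: 'f::rc_field \<Rightarrow> real)"
proof (rule bounded_linear_intro[where K = 1])
  fix x y :: 'f and r :: real
  have "(of_real (rc_re (x + y)) :: 'f) = of_real (rc_re x + rc_re y)"
    by (simp add: of_real_rc_re conjugate_add add_divide_distrib)
  then show "rc_re (x + y) = rc_re x + rc_re y" by (simp only: of_real_eq_iff)
  have "(of_real (rc_re (r *\<^sub>R x)) :: 'f) = of_real (r * rc_re x)"
    by (simp add: of_real_rc_re scaleR_conv_of_real conjugate_mult conjugate_of_real distrib_left)
  then show "rc_re (r *\<^sub>R x) = r *\<^sub>R rc_re x" by (simp only: of_real_eq_iff real_scaleR_def)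
  have "norm (of_real (rc_re x) :: 'f) \<le> norm x"
    using norm_triangle_ineq[of x "conjugate x"] by (simp add: of_real_rc_re norm_divide)
  then show "norm (rc_re x) \<le> norm x * 1" by simp
qed

lemmas rc_re_diff = linear_diff[OF bounded_linear.linear[OF bounded_linear_rc_re]]

lemma rc_eqI:
  assumes "\<And>c. rc_re (c * a) = rc_re (c * b)"
  shows "a = (b :: 'f::rc_field)"
proof -
  have "(norm (a - b))\<^sup>2 = rc_re (conjugate (a - b) * (a - b))"
    by (simp only: mult.commute[of "conjugate _"] mult_conjugate_of_real rc_re_of_real)
  also have "\<dots> = 0" by (simp add: right_diff_distrib rc_re_diff assms)
  finally show ?thesis by simp
qed


section \<open>Symmetric coercive forms\<close>

lemma bounded_linear_compose_bilinear:
  assumes f: "bounded_linear f" and b: "bounded_bilinear b"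
  shows "bounded_bilinear (\<lambda>x y. f (b x y))"
proof -
  interpret f: bounded_linear f by fact
  interpret b: bounded_bilinear b by fact
  obtain K L where K: "0 \<le> K" "\<And>x. norm (f x) \<le> norm x * K"
    and L: "\<And>x y. norm (b x y) \<le> norm x * norm y * L"
    using f.nonneg_bounded b.bounded by blast
  have "norm (f (b x y)) \<le> norm x * norm y * (L * K)" for x y
    using mult_right_mono[OF L[of x y] K(1)] K(2)[of "b x y"] by (simp add: mult.assoc)
  then show ?thesis
    by (intro bounded_bilinear.intro)
      (auto simp: b.add_left b.add_right b.scaleR_left b.scaleR_right f.add f.scaleR)
qed

lemma attains_min_if_sublevels_shrink:
  fixes J :: "'a::complete_space \<Rightarrow> real"
  defines "m \<equiv> INF x. J x"
  assumes J: "continuous_on UNIV J" and bdd: "bdd_below (range J)"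
    and shrink: "\<And>e. 0 < e \<Longrightarrow> \<exists>d>0. \<forall>x y. J x \<le> m + d \<longrightarrow> J y \<le> m + d \<longrightarrow> dist x y < e"
  shows "\<exists>z. \<forall>x. J z \<le> J x"
proof -
  define S where "S n = {x. J x \<le> m + 1 / real (Suc n)}" for n
  obtain z where z: "\<And>n. z \<in> S n"
  proof (rule decreasing_closed_nest[of S])
    show "closed (S n)" for n
      unfolding S_def by (intro closed_Collect_le J continuous_intros)
    show "S n \<noteq> {}" for n
    proof -
      have "\<exists>y\<in>range J. y < m + 1 / real (Suc n)" unfolding m_def by (intro cInf_lessD) auto
      then show ?thesis by (auto simp: S_def intro: less_imp_le)
    qed
    show "S n \<subseteq> S k" if "k \<le> n" for k n
    proof -
      have "1 / real (Suc n) \<le> 1 / real (Suc k)" using that by (simp add: frac_le)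
      then show ?thesis by (force simp: S_def)
    qed
    show "\<exists>n. \<forall>x\<in>S n. \<forall>y\<in>S n. dist x y < e" if e: "0 < e" for e
    proof -
      obtain d where "0 < d" and d: "\<And>x y. J x \<le> m + d \<Longrightarrow> J y \<le> m + d \<Longrightarrow> dist x y < e"
        using shrink[OF e] by blast
      obtain n where "1 / real (Suc n) < d" using \<open>0 < d\<close> by (rule nat_approx_posE)
      then have "\<forall>x\<in>S n. \<forall>y\<in>S n. dist x y < e" by (auto simp: S_def intro!: d)
      then show ?thesis ..
    qed
  qed (rule that)
  have "J z \<le> m"
  proof (rule field_le_epsilon)
    fix e :: real assume "0 < e"
    then obtain n where "1 / real (Suc n) < e" by (rule nat_approx_posE)
    with z[of n] show "J z \<le> m + e" by (simp add: S_def)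
  qed
  moreover have "m \<le> J x" for x unfolding m_def by (rule cINF_lower[OF bdd]) simp
  ultimately show ?thesis by (meson order_trans)
qed

lemma strongly_midpoint_convex_attains_min:
  fixes J :: "'a::banach \<Rightarrow> real"
  assumes J: "continuous_on UNIV J" and bdd: "bdd_below (range J)"
    and a: "0 < a" and convex: "\<And>x y. J (midpoint x y) \<le> (J x + J y) / 2 - a * (dist x y)\<^sup>2"
  shows "\<exists>z. \<forall>x. J z \<le> J x"
proof (rule attains_min_if_sublevels_shrink[OF J bdd])
  fix e :: real assume e: "0 < e"
  define m where "m = (INF x. J x)"
  have "dist x y < e" if "J x \<le> m + a * e\<^sup>2 / 2" "J y \<le> m + a * e\<^sup>2 / 2" for x y
  proof -
    have "m \<le> J (midpoint x y)" unfolding m_def by (rule cINF_lower[OF bdd]) simp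
    moreover have "0 < a * e\<^sup>2" using a e by simp
    ultimately have "a * (dist x y)\<^sup>2 < a * e\<^sup>2" using that convex[of x y] by argo
    then show ?thesis using a e by (simp add: power_less_imp_less_base)
  qed
  then show "\<exists>d>0. \<forall>x y. J x \<le> (INF x. J x) + d \<longrightarrow> J y \<le> (INF x. J x) + d \<longrightarrow> dist x y < e"
    using a e unfolding m_def by (intro exI[of _ "a * e\<^sup>2 / 2"]) simp
qed

lemma energy_minimiser_represents:
  fixes b :: "'a::real_normed_vector \<Rightarrow> 'a \<Rightarrow> real"
  assumes b: "bounded_bilinear b" and sym: "\<And>x y. b x y = b y x" and g: "bounded_linear g"
    and min: "\<And>x. b z z - 2 * g z \<le> b x x - 2 * g x"
  shows "g x = b x z"
proof -
  interpret b: bounded_bilinear b by fact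
  interpret g: bounded_linear g by fact
  define J where "J x = b x x - 2 * g x" for x
  have "J (z + t *\<^sub>R x) = J z + t\<^sup>2 * b x x + 2 * t * (b x z - g x)" for t
    by (simp add: J_def b.add_left b.add_right b.scaleR_left b.scaleR_right g.add g.scaleR
        sym[of z x] power2_eq_square algebra_simps)
  then have "((\<lambda>t. J (z + t *\<^sub>R x)) has_real_derivative 2 * (b x z - g x)) (at 0)"
    by (auto intro!: derivative_eq_intros)
  from DERIV_local_min[OF this zero_less_one] min show ?thesis by (simp add: J_def)
qed

lemma symmetric_lax_milgram:
  fixes b :: "'a::banach \<Rightarrow> 'a \<Rightarrow> real"
  assumes b: "bounded_bilinear b" and sym: "\<And>x y. b x y = b y x"
    and a: "0 < a" and coercive: "\<And>x. a * (norm x)\<^sup>2 \<le> b x x"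
    and g: "bounded_linear g"
  shows "\<exists>z. \<forall>x. g x = b x z"
proof -
  interpret b: bounded_bilinear b by fact
  interpret g: bounded_linear g by fact
  define J where "J x = b x x - 2 * g x" for x
  have "- (onorm g)\<^sup>2 / a \<le> J x" for x
  proof -
    have "0 \<le> (a * norm x - onorm g)\<^sup>2 / a" using a by simp
    also have "\<dots> = a * (norm x)\<^sup>2 - 2 * (onorm g * norm x) + (onorm g)\<^sup>2 / a"
      using a by (simp add: power2_eq_square field_simps)
    finally show ?thesis using onorm[OF g, of x] coercive[of x] by (simp add: J_def)
  qed
  then have "bdd_below (range J)" by (intro bdd_belowI) auto
  moreover have "continuous_on UNIV J"
    unfolding J_def by (intro continuous_intros b.continuous_on g.continuous_on)
  moreover have "J (midpoint x y) \<le> (J x + J y) / 2 - a / 4 * (dist x y)\<^sup>2" for x y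
  proof -
    have "J (midpoint x y) = (J x + J y) / 2 - b (x - y) (x - y) / 4"
      by (simp add: J_def midpoint_def b.add_left b.add_right b.diff_left b.diff_right
          b.scaleR_left b.scaleR_right g.add g.scaleR sym[of y x] field_simps)
    then show ?thesis using coercive[of "x - y"] by (simp add: dist_norm)
  qed
  ultimately obtain z where "\<And>x. J z \<le> J x"
    using strongly_midpoint_convex_attains_min[of J "a / 4"] a by auto
  then show ?thesis using energy_minimiser_represents[OF b sym g] unfolding J_def by blast
qed


section \<open>Inner product spaces\<close>

text \<open>The axioms of \<open>hilbert_space\<close> without completeness: they hold for \<open>ell2 K\<close>, whose completeness
  is never needed, because the only projection in \<open>\<ell>\<^sup>2\<close> that occurs has an explicit formula.\<close>

locale pre_hilbert = vector_space "scl H"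
  for H :: "('f::rc_field, 'a::real_normed_vector) hilbert" +
  assumes scl_of_real: "scl H (of_real r) x = r *\<^sub>R x"
    and ip_add: "ip H (x + y) z = ip H x z + ip H y z"
    and ip_scl: "ip H (scl H c x) y = c * ip H x y"
    and ip_conjugate: "ip H y x = conjugate (ip H x y)"
    and ip_self: "ip H x x = of_real ((norm x)\<^sup>2)"

lemma (in hilbert_space) is_pre_hilbert: "pre_hilbert H"
  by unfold_locales (fact scl_of_real ip_add ip_scl ip_conjugate ip_self)+

sublocale hilbert_space \<subseteq> pre_hilbert
  by (rule is_pre_hilbert)

context pre_hilbert
begin

lemma norm_ip_self: "norm (ip H x x) = (norm x)\<^sup>2"
  by (simp add: ip_self del: of_real_power)

lemma ip_add_right: "ip H x (y + z) = ip H x y + ip H x z"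
  by (metis conjugate_add ip_add ip_conjugate)

lemma ip_scl_right: "ip H x (scl H c y) = conjugate c * ip H x y"
  by (metis conjugate_mult ip_scl ip_conjugate)

lemma ip_scaleR: "ip H (r *\<^sub>R x) y = r *\<^sub>R ip H x y"
  using ip_scl[of "of_real r" x y] by (simp add: scl_of_real scaleR_conv_of_real)

lemma ip_scaleR_right: "ip H x (r *\<^sub>R y) = r *\<^sub>R ip H x y"
  using ip_scl_right[of x "of_real r" y]
  by (simp add: scl_of_real conjugate_of_real scaleR_conv_of_real)

text \<open>Cauchy--Schwarz, by expanding \<open>\<parallel>u\<parallel>\<^sup>2\<close> for \<open>u = \<parallel>y\<parallel>\<^sup>2 x - \<langle>x, y\<rangle> y\<close>, which is orthogonal to \<open>y\<close>.\<close>

lemma norm_ip_le: "norm (ip H x y) \<le> norm x * norm y"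
proof (cases "y = 0")
  case True
  then show ?thesis using ip_scaleR_right[of x 0 0] by simp
next
  case False
  define n where "n = (norm y)\<^sup>2"
  define u where "u = n *\<^sub>R x + scl H (- ip H x y) y"
  have n: "0 < n" using False by (simp add: n_def)
  have uy: "ip H u y = 0"
    unfolding u_def ip_add ip_scaleR ip_scl ip_self by (simp add: n_def scaleR_conv_of_real)
  have "of_real ((norm u)\<^sup>2) = ip H u (n *\<^sub>R x + scl H (- ip H x y) y)"
    by (simp only: ip_self[symmetric] u_def)
  also have "\<dots> = of_real n * ip H u x"
    unfolding ip_add_right ip_scaleR_right ip_scl_right uy by (simp add: scaleR_conv_of_real)
  also have "ip H u x = of_real (n * (norm x)\<^sup>2) - ip H x y * conjugate (ip H x y)"
    unfolding u_def ip_add ip_scaleR ip_scl ip_self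
    by (simp add: scaleR_conv_of_real flip: ip_conjugate)
  also have "\<dots> = of_real (n * (norm x)\<^sup>2 - (norm (ip H x y))\<^sup>2)"
    by (simp only: mult_conjugate_of_real of_real_diff)
  finally have "(norm u)\<^sup>2 = n * (n * (norm x)\<^sup>2 - (norm (ip H x y))\<^sup>2)"
    by (simp only: of_real_eq_iff flip: of_real_mult)
  with n have "0 \<le> n * (norm x)\<^sup>2 - (norm (ip H x y))\<^sup>2"
    by (metis zero_le_power2 zero_le_mult_iff not_less)
  then have "(norm (ip H x y))\<^sup>2 \<le> (norm x * norm y)\<^sup>2"
    by (simp add: n_def power_mult_distrib mult.commute)
  then show ?thesis by (rule power2_le_imp_le) simp
qed

lemma bounded_bilinear_ip: "bounded_bilinear (ip H)"
  by (intro bounded_bilinear.intro ip_add ip_add_right ip_scaleR ip_scaleR_right exI[of _ 1])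
    (simp add: norm_ip_le)

sublocale ip: bounded_bilinear "ip H"
  by (rule bounded_bilinear_ip)

lemma ip_eqI:
  assumes "\<And>x. ip H x y = ip H x z"
  shows "y = z"
  using norm_ip_self[of "y - z"] by (simp add: ip.diff_right assms)

lemma norm_scl: "norm (scl H c x) = norm c * norm x"
proof -
  have "(norm (scl H c x))\<^sup>2 = (norm c * norm x)\<^sup>2"
    unfolding norm_ip_self[symmetric]
    by (simp add: ip_scl ip_scl_right norm_mult norm_ip_self power2_eq_square ac_simps)
  then show ?thesis by (simp add: power2_eq_iff_nonneg)
qed

lemma norm_le_if_norm_ip_self_le:
  assumes "norm (ip H x x) \<le> norm x * r" and "0 \<le> r"
  shows "norm x \<le> r"
  using assms by (cases "x = 0") (simp_all add: norm_ip_self power2_eq_square)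

lemma bops_add:
  fixes T U :: "'b::real_normed_vector \<Rightarrow>\<^sub>L 'a"
  assumes "T \<in> bops G H" and "U \<in> bops G H"
  shows "T + U \<in> bops G H"
  using assms by (simp add: bops_def blinfun.add_left scale_right_distrib)

lemma bops_diff:
  fixes T U :: "'b::real_normed_vector \<Rightarrow>\<^sub>L 'a"
  assumes "T \<in> bops G H" and "U \<in> bops G H"
  shows "T - U \<in> bops G H"
  using assms by (simp add: bops_def blinfun.diff_left scale_right_diff_distrib)

lemma orth_proj_eqI:
  fixes P :: "'a \<Rightarrow>\<^sub>L 'a"
  assumes V: "\<And>u v. u \<in> V \<Longrightarrow> v \<in> V \<Longrightarrow> u - v \<in> V"
    and P: "\<And>x. P x \<in> V" "\<And>x v. v \<in> V \<Longrightarrow> ip H (x - P x) v = 0"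
  shows "orth_proj H V = P"
proof -
  have "(THE p. p \<in> V \<and> (\<forall>v\<in>V. ip H (x - p) v = 0)) = P x" for x
  proof (rule the_equality)
    fix p assume p: "p \<in> V \<and> (\<forall>v\<in>V. ip H (x - p) v = 0)"
    then have "p - P x \<in> V" using V P(1) by blast
    with p P(2) have "ip H ((x - P x) - (x - p)) (p - P x) = 0"
      by (simp only: ip.diff_left[of "x - P x"]) simp
    then show "p = P x" using norm_ip_self[of "p - P x"] by simp
  qed (use P in blast)
  then show ?thesis by (simp add: orth_proj_def blinfun_apply_inverse)
qed

end

lemma bops_compose:
  assumes "T \<in> bops Y Z" and "U \<in> bops X Y"
  shows "T o\<^sub>L U \<in> bops X Z"
  using assms by (simp add: bops_def)

lemma blinfun_compose_eq_id_iff: "T o\<^sub>L U = id_blinfun \<longleftrightarrow> (\<forall>x. T (U x) = x)"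
  by (metis blinfun_eqI blinfun_apply_blinfun_compose blinfun_apply_id_blinfun)

interpretation blinfun_compose: bounded_bilinear "(o\<^sub>L)"
  by (rule bounded_bilinear_blinfun_compose)


section \<open>Adjoints and operators bounded below\<close>

locale hilbert_pair = X: hilbert_space X + Y: pre_hilbert Y
  for X :: "('f::rc_field, 'a::banach) hilbert" and Y :: "('f, 'b::real_normed_vector) hilbert"

locale bounded_below = hilbert_pair +
  fixes T :: "'b \<Rightarrow>\<^sub>L 'c" and c :: real
  assumes T: "T \<in> bops X Y" and c_pos: "0 < c" and below: "c * norm x \<le> norm (T x)"

lemma (in bounded_below) ex_representing_vector:
  assumes f: "bounded_linear f" and scl: "\<And>a x. f (scl X a x) = a * f x"
  shows "\<exists>z. \<forall>x. f x = ip Y (T x) (T z)"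
proof -
  have "\<exists>z. \<forall>x. rc_re (f x) = rc_re (ip Y (T x) (T z))"
  proof (rule symmetric_lax_milgram)
    show "bounded_bilinear (\<lambda>x y. rc_re (ip Y (T x) (T y)))"
      by (rule bounded_linear_compose_bilinear[OF bounded_linear_rc_re
          Y.ip.comp[OF blinfun.bounded_linear_right[of T] blinfun.bounded_linear_right[of T]]])
    show "rc_re (ip Y (T x) (T y)) = rc_re (ip Y (T y) (T x))" for x y
      by (simp add: Y.ip_conjugate[of "T x"])
    show "c\<^sup>2 * (norm x)\<^sup>2 \<le> rc_re (ip Y (T x) (T x))" for x
      using power_mono[OF below[of x], of 2] c_pos
      by (simp add: Y.ip_self power_mult_distrib del: of_real_power)
  qed (use c_pos in \<open>simp_all add: bounded_linear_compose[OF bounded_linear_rc_re f]\<close>)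
  then obtain z where z: "\<And>x. rc_re (f x) = rc_re (ip Y (T x) (T z))" by blast
  have "f x = ip Y (T x) (T z)" for x
  proof (rule rc_eqI)
    show "rc_re (a * f x) = rc_re (a * ip Y (T x) (T z))" for a
      using z[of "scl X a x"] T by (simp add: scl bops_def Y.ip_scl)
  qed
  then show ?thesis by blast
qed

lemma (in hilbert_space) riesz:
  assumes "bounded_linear f" and "\<And>a x. f (scl H a x) = a * f x"
  shows "\<exists>z. \<forall>x. f x = ip H x z"
proof -
  interpret id: bounded_below H H id_blinfun 1
    by unfold_locales (simp_all add: bops_def)
  show ?thesis using id.ex_representing_vector[OF assms] by simp
qed

context hilbert_pair
begin

lemma adj_eqI:
  fixes T :: "'a \<Rightarrow>\<^sub>L 'b" and U :: "'b \<Rightarrow>\<^sub>L 'a"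
  assumes "\<And>x y. ip Y (T x) y = ip X x (U y)"
  shows "adj X Y T = U"
proof -
  have "(THE z. \<forall>x. ip Y (T x) y = ip X x z) = U y" for y
    using assms by (intro the_equality X.ip_eqI) auto
  then show ?thesis by (simp add: adj_def blinfun_apply_inverse)
qed

lemma norm_le_if_ip_eq:
  fixes T :: "'a \<Rightarrow>\<^sub>L 'b"
  assumes "\<And>x. ip Y (T x) y = ip X x z"
  shows "norm z \<le> norm T * norm y"
proof (rule X.norm_le_if_norm_ip_self_le)
  have "norm (ip X z z) \<le> norm (T z) * norm y"
    by (simp add: Y.norm_ip_le flip: assms)
  also have "\<dots> \<le> (norm T * norm z) * norm y"
    by (intro mult_right_mono norm_blinfun) simp
  finally show "norm (ip X z z) \<le> norm z * (norm T * norm y)" by (simp add: ac_simps)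
qed simp

lemma ip_adj:
  assumes T: "T \<in> bops X Y"
  shows "ip Y (T x) y = ip X x (adj X Y T y)"
proof -
  have "\<exists>z. \<forall>x. ip Y (T x) y = ip X x z" for y
  proof (rule X.riesz)
    show "bounded_linear (\<lambda>x. ip Y (T x) y)"
      by (rule bounded_linear_compose[OF Y.ip.bounded_linear_left blinfun.bounded_linear_right])
  qed (use T in \<open>simp add: bops_def Y.ip_scl\<close>)
  then obtain h where h: "\<And>x y. ip Y (T x) y = ip X x (h y)" by metis
  have "bounded_linear h"
  proof (rule bounded_linear_intro[where K = "norm T"])
    show "h (y + z) = h y + h z" for y z
      by (rule X.ip_eqI) (simp add: h[symmetric] Y.ip.add_right X.ip.add_right)
    show "h (r *\<^sub>R y) = r *\<^sub>R h y" for r y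
      by (rule X.ip_eqI) (simp add: h[symmetric] Y.ip.scaleR_right X.ip.scaleR_right)
    show "norm (h y) \<le> norm y * norm T" for y
      using norm_le_if_ip_eq[OF h] by (simp add: mult.commute)
  qed
  then have "adj X Y T = Blinfun h"
    by (intro adj_eqI) (simp add: bounded_linear_Blinfun_apply h)
  then show ?thesis by (simp add: \<open>bounded_linear h\<close> bounded_linear_Blinfun_apply h)
qed

lemma ip_adj_left:
  assumes "T \<in> bops X Y"
  shows "ip X (adj X Y T y) x = ip Y y (T x)"
  by (simp only: X.ip_conjugate[of _ x] Y.ip_conjugate[of _ "T x"] ip_adj[OF assms])

lemma adj_in_bops:
  assumes "T \<in> bops X Y"
  shows "adj X Y T \<in> bops Y X"
proof -
  have "adj X Y T (scl Y a y) = scl X a (adj X Y T y)" for a y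
    by (rule X.ip_eqI) (simp add: X.ip_scl_right Y.ip_scl_right flip: ip_adj[OF assms])
  then show ?thesis by (simp add: bops_def)
qed

lemma norm_adj_le:
  assumes "T \<in> bops X Y"
  shows "norm (adj X Y T) \<le> norm T"
  by (intro norm_blinfun_bound norm_le_if_ip_eq ip_adj assms norm_ge_zero)

lemma adj_diff:
  assumes T: "T \<in> bops X Y" and U: "U \<in> bops X Y"
  shows "adj X Y (T - U) = adj X Y T - adj X Y U"
  by (rule adj_eqI)
    (simp add: blinfun.diff_left Y.ip.diff_left X.ip.diff_right ip_adj[OF T] ip_adj[OF U])

lemma adj_compose_eq_id_swap:
  assumes T: "T \<in> bops X Y" and U: "U \<in> bops X Y" and id: "adj X Y T o\<^sub>L U = id_blinfun"
  shows "adj X Y U o\<^sub>L T = id_blinfun"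
proof (intro blinfun_eqI X.ip_eqI)
  fix x z
  have "adj X Y T (U z) = z" using id by (simp add: blinfun_compose_eq_id_iff)
  then show "ip X z ((adj X Y U o\<^sub>L T) x) = ip X z (id_blinfun x)"
    by (simp flip: ip_adj[OF U] ip_adj_left[OF T])
qed

end

lemma
  fixes S :: "'a::real_normed_vector \<Rightarrow>\<^sub>L 'b::real_normed_vector"
  assumes "surj S" and d: "0 < d" "\<And>x. d * norm x \<le> norm (S x)"
  shows blinfun_inv_right: "S (blinfun_inv S y) = y"
    and blinfun_inv_left: "blinfun_inv S (S x) = x"
proof -
  have "inj S"
  proof (rule injI)
    fix x y assume "S x = S y"
    then have "d * norm (x - y) \<le> 0" using d(2)[of "x - y"] by (simp add: blinfun.diff_right)
    then show "x = y" using d(1) by (simp add: mult_le_0_iff)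
  qed
  then have left: "inv S (S x) = x" and right: "S (inv S y) = y" for x y
    using \<open>surj S\<close> by (simp_all add: surj_f_inv_f)
  have "bounded_linear (inv S)"
  proof (rule bounded_linear_intro[where K = "1 / d"])
    show "inv S (x + y) = inv S x + inv S y" for x y
      by (metis left right blinfun.add_right)
    show "inv S (r *\<^sub>R x) = r *\<^sub>R inv S x" for r x
      by (metis left right blinfun.scaleR_right)
    show "norm (inv S x) \<le> norm x * (1 / d)" for x
      using d(2)[of "inv S x"] d(1) by (simp add: right field_simps)
  qed
  then have "blinfun_apply (blinfun_inv S) = inv S"
    by (simp add: blinfun_inv_def bounded_linear_Blinfun_apply)
  then show "S (blinfun_inv S y) = y" and "blinfun_inv S (S x) = x"
    by (simp_all add: left right)
qed

context bounded_below
begin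

definition gram :: "'b \<Rightarrow>\<^sub>L 'b" where
  "gram = adj X Y T o\<^sub>L T"

lemma ip_gram: "ip X x (gram z) = ip Y (T x) (T z)"
  by (simp add: gram_def ip_adj[OF T])

lemma surj_gram: "surj gram"
  unfolding surj_def
proof
  fix y
  obtain z where "\<And>x. ip X x y = ip Y (T x) (T z)"
    using ex_representing_vector[OF X.ip.bounded_linear_left X.ip_scl] by blast
  then have "y = gram z" by (intro X.ip_eqI) (simp add: ip_gram)
  then show "\<exists>z. y = gram z" ..
qed

lemma norm_gram_ge: "c\<^sup>2 * norm x \<le> norm (gram x)"
proof (cases "x = 0")
  case False
  have "(c * norm x)\<^sup>2 \<le> (norm (T x))\<^sup>2" using below[of x] c_pos by (intro power_mono) auto
  also have "\<dots> \<le> norm x * norm (gram x)"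
    using X.norm_ip_le[of x "gram x"] by (simp add: ip_gram Y.norm_ip_self)
  finally have "norm x * (c\<^sup>2 * norm x) \<le> norm x * norm (gram x)"
    by (simp add: power2_eq_square ac_simps)
  then show ?thesis using False by simp
qed simp

lemmas gram_inv_right = blinfun_inv_right[OF surj_gram zero_less_power[OF c_pos] norm_gram_ge]
  and gram_inv_left = blinfun_inv_left[OF surj_gram zero_less_power[OF c_pos] norm_gram_ge]

text \<open>For \<open>T = T\<^sub>A\<close> this is the analysis operator of the canonical dual frame of \<open>A\<close>.\<close>

definition canonical_dual :: "'b \<Rightarrow>\<^sub>L 'c" where
  "canonical_dual = T o\<^sub>L blinfun_inv gram"

lemma adj_canonical_dual: "adj X Y T (canonical_dual x) = x"
  using gram_inv_right[of x] by (simp add: canonical_dual_def gram_def)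

lemma canonical_dual_in_bops: "canonical_dual \<in> bops X Y"
proof -
  have "gram \<in> bops X X" unfolding gram_def by (rule bops_compose[OF adj_in_bops[OF T] T])
  then have "gram (scl X a (blinfun_inv gram x)) = scl X a x" for a x
    by (simp add: bops_def gram_inv_right)
  then have "blinfun_inv gram (scl X a x) = scl X a (blinfun_inv gram x)" for a x
    by (metis gram_inv_left)
  then have "blinfun_inv gram \<in> bops X X" by (simp add: bops_def)
  then show ?thesis unfolding canonical_dual_def by (rule bops_compose[OF T])
qed

lemma norm_canonical_dual_le: "norm canonical_dual \<le> 1 / c"
proof (rule norm_blinfun_bound)
  fix x
  let ?y = "blinfun_inv gram x"
  have "norm (T ?y) \<le> norm x / c"
  proof (rule Y.norm_le_if_norm_ip_self_le)
    have "norm (ip Y (T ?y) (T ?y)) \<le> norm ?y * norm x"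
      unfolding ip_gram[symmetric] gram_inv_right by (rule X.norm_ip_le)
    also have "\<dots> \<le> norm (T ?y) / c * norm x"
      using below[of ?y] c_pos by (intro mult_right_mono) (simp_all add: field_simps)
    finally show "norm (ip Y (T ?y) (T ?y)) \<le> norm (T ?y) * (norm x / c)" by simp
  qed (use c_pos in simp)
  then show "norm (canonical_dual x) \<le> 1 / c * norm x" by (simp add: canonical_dual_def)
qed (use c_pos in simp)

lemma ip_canonical_dual_adj: "ip Y (canonical_dual x) y = ip X (blinfun_inv gram x) (adj X Y T y)"
  by (simp add: canonical_dual_def ip_adj[OF T])

text \<open>\<open>canonical_dual o\<^sub>L adj X Y T\<close> is the orthogonal projection onto the range of \<open>T\<close>.\<close>

lemma norm_canonical_dual_adj_le: "norm (canonical_dual o\<^sub>L adj X Y T) \<le> 1"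
proof (rule norm_blinfun_bound)
  fix y
  let ?q = "canonical_dual (adj X Y T y)"
  have "ip Y ?q ?q = ip Y ?q y" by (simp add: ip_canonical_dual_adj adj_canonical_dual)
  then have "norm ?q \<le> norm y"
    by (intro Y.norm_le_if_norm_ip_self_le) (simp_all add: Y.norm_ip_le)
  then show "norm ((canonical_dual o\<^sub>L adj X Y T) y) \<le> 1 * norm y" by simp
qed simp

end


section \<open>The inner product on square-summable sequences\<close>

lemma ell2_sq_summable: "(\<lambda>i. (norm (seq f i))\<^sup>2) summable_on A"
  using seq[of f] by (auto intro: summable_on_subset)

lemma norm_ell2_sq: "(norm f)\<^sup>2 = (\<Sum>\<^sub>\<infinity>i. (norm (seq f i))\<^sup>2)"
  by (simp add: norm_ell2.rep_eq infsum_nonneg)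

lemma ell2_eqI: "(\<And>i. seq f i = seq g i) \<Longrightarrow> f = g"
  by (simp add: seq_inject[symmetric] fun_eq_iff)

definition ell2_restrict :: "nat set \<Rightarrow> 'k::real_normed_vector ell2 \<Rightarrow>\<^sub>L 'k ell2" where
  "ell2_restrict I = Blinfun (\<lambda>f. Abs_ell2 (\<lambda>i. if i \<in> I then seq f i else 0))"

lemma seq_ell2_restrict:
  fixes f :: "'k::real_normed_vector ell2"
  shows "seq (ell2_restrict I f) i = (if i \<in> I then seq f i else 0)"
proof -
  let ?r = "\<lambda>f :: 'k ell2. Abs_ell2 (\<lambda>i. if i \<in> I then seq f i else 0)"
  have "(\<lambda>i. (norm (if i \<in> I then seq f i else 0))\<^sup>2) summable_on UNIV" for f :: "'k ell2"
    using ell2_sq_summable[of f UNIV] by (rule summable_on_comparison_test) auto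
  then have seq: "seq (?r f) = (\<lambda>i. if i \<in> I then seq f i else 0)" for f
    by (simp add: Abs_ell2_inverse)
  have "bounded_linear ?r"
  proof (rule bounded_linear_intro[where K = 1])
    fix f :: "'k ell2"
    have "(norm (?r f))\<^sup>2 \<le> (norm f)\<^sup>2"
      using ell2_sq_summable[of "?r f" UNIV] ell2_sq_summable[of f UNIV]
      unfolding norm_ell2_sq by (intro infsum_mono) (auto simp: seq)
    then show "norm (?r f) \<le> norm f * 1" using power2_le_imp_le by auto
  qed (auto intro!: ell2_eqI simp: seq plus_ell2.rep_eq scaleR_ell2.rep_eq)
  then show ?thesis by (simp add: ell2_restrict_def bounded_linear_Blinfun_apply seq)
qed

lemma ell2_restrict_in_ell2_on: "ell2_restrict I f \<in> ell2_on I"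
  by (simp add: ell2_on_def seq_ell2_restrict)

lemma ell2_restrict_id: "f \<in> ell2_on I \<Longrightarrow> ell2_restrict I f = f"
  by (rule ell2_eqI) (auto simp: ell2_on_def seq_ell2_restrict)

lemma ell2_on_add: "f \<in> ell2_on I \<Longrightarrow> g \<in> ell2_on I \<Longrightarrow> f + g \<in> ell2_on I"
  and ell2_on_diff: "f \<in> ell2_on I \<Longrightarrow> g \<in> ell2_on I \<Longrightarrow> f - g \<in> ell2_on I"
  by (simp_all add: ell2_on_def plus_ell2.rep_eq minus_ell2.rep_eq)

lemma norm_sq_ell2_on: "f \<in> ell2_on I \<Longrightarrow> (norm f)\<^sup>2 = (\<Sum>\<^sub>\<infinity>i\<in>I. (norm (seq f i))\<^sup>2)"
  unfolding norm_ell2_sq by (rule infsum_cong_neutral) (auto simp: ell2_on_def)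

lemma norm_sq_ell2_restrict: "(norm (ell2_restrict I f))\<^sup>2 = (\<Sum>\<^sub>\<infinity>i\<in>I. (norm (seq f i))\<^sup>2)"
  by (simp add: norm_sq_ell2_on[OF ell2_restrict_in_ell2_on] seq_ell2_restrict cong: infsum_cong)

lemma norm_ell2_restrict_le: "norm (ell2_restrict I f) \<le> norm f"
proof (rule power2_le_imp_le)
  show "(norm (ell2_restrict I f))\<^sup>2 \<le> (norm f)\<^sup>2"
    unfolding norm_sq_ell2_restrict norm_ell2_sq[of f]
    by (intro infsum_mono_neutral ell2_sq_summable) auto
qed simp

lemma tendsto_ell2_restrict:
  "((\<lambda>F. ell2_restrict F f) \<longlongrightarrow> ell2_restrict I f) (finite_subsets_at_top I)"
proof -
  let ?q = "\<lambda>i. (norm (seq f i))\<^sup>2"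
  have "(norm (ell2_restrict F f - ell2_restrict I f))\<^sup>2 = infsum ?q I - sum ?q F"
    if F: "finite F" "F \<subseteq> I" for F
  proof -
    have "ell2_restrict I f - ell2_restrict F f = ell2_restrict (I - F) f"
      using F by (intro ell2_eqI) (auto simp: minus_ell2.rep_eq seq_ell2_restrict)
    then show ?thesis
      using F by (simp add: norm_minus_commute[of "ell2_restrict F f"] norm_sq_ell2_restrict
          infsum_Diff ell2_sq_summable)
  qed
  then have eq: "\<forall>\<^sub>F F in finite_subsets_at_top I. infsum ?q I - sum ?q F
      = (norm (ell2_restrict F f - ell2_restrict I f))\<^sup>2"
    by (intro eventually_finite_subsets_at_top_weakI) simp
  have "((\<lambda>F. infsum ?q I - sum ?q F) \<longlongrightarrow> infsum ?q I - infsum ?q I) (finite_subsets_at_top I)"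
    by (intro tendsto_diff tendsto_const infsum_tendsto ell2_sq_summable)
  then have "((\<lambda>F. (norm (ell2_restrict F f - ell2_restrict I f))\<^sup>2) \<longlongrightarrow> 0) (finite_subsets_at_top I)"
    using tendsto_cong[OF eq] by simp
  then show ?thesis by (simp add: tendsto_norm_zero_iff LIM_zero_iff)
qed

context pre_hilbert
begin

lemma ell2_ip_summable: "(\<lambda>i. ip H (seq f i) (seq g i)) summable_on A"
proof (rule abs_summable_summable, rule Infinite_Sum.abs_summable_on_comparison_test')
  show "(\<lambda>i. (norm (seq f i))\<^sup>2 + (norm (seq g i))\<^sup>2) summable_on A"
    by (intro summable_on_add ell2_sq_summable)
  show "norm (ip H (seq f i) (seq g i)) \<le> (norm (seq f i))\<^sup>2 + (norm (seq g i))\<^sup>2" for i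
  proof -
    have "2 * (norm (seq f i) * norm (seq g i)) \<le> (norm (seq f i))\<^sup>2 + (norm (seq g i))\<^sup>2"
      using sum_squares_bound[of "norm (seq f i)" "norm (seq g i)"] by (simp add: mult.assoc)
    then show ?thesis
      using norm_ip_le[of "seq f i" "seq g i"] norm_ge_zero[of "ip H (seq f i) (seq g i)"]
      by linarith
  qed
qed

lemma seq_scl_ell2: "seq (scl (ell2 H) c f) i = scl H c (seq f i)"
proof -
  have "(\<lambda>i. (norm (scl H c (seq f i)))\<^sup>2) summable_on UNIV"
    by (simp add: norm_scl power_mult_distrib summable_on_cmult_right ell2_sq_summable)
  then show ?thesis by (simp add: ell2_def Abs_ell2_inverse)
qed

lemma ip_ell2: "ip (ell2 H) f g = (\<Sum>\<^sub>\<infinity>i. ip H (seq f i) (seq g i))"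
  by (simp add: ell2_def)

lemma pre_hilbert_ell2: "pre_hilbert (ell2 H)"
proof
  fix a b :: 'f and x y z :: "'a ell2" and r :: real
  show "scl (ell2 H) a (x + y) = scl (ell2 H) a x + scl (ell2 H) a y"
    by (rule ell2_eqI) (simp add: seq_scl_ell2 plus_ell2.rep_eq scale_right_distrib)
  show "scl (ell2 H) (a + b) x = scl (ell2 H) a x + scl (ell2 H) b x"
    by (rule ell2_eqI) (simp add: seq_scl_ell2 plus_ell2.rep_eq scale_left_distrib)
  show "scl (ell2 H) a (scl (ell2 H) b x) = scl (ell2 H) (a * b) x"
    by (rule ell2_eqI) (simp add: seq_scl_ell2)
  show "scl (ell2 H) 1 x = x"
    by (rule ell2_eqI) (simp add: seq_scl_ell2)
  show "scl (ell2 H) (of_real r) x = r *\<^sub>R x"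
    by (rule ell2_eqI) (simp add: seq_scl_ell2 scaleR_ell2.rep_eq scl_of_real)
  show "ip (ell2 H) (x + y) z = ip (ell2 H) x z + ip (ell2 H) y z"
    by (simp add: ip_ell2 plus_ell2.rep_eq ip.add_left infsum_add ell2_ip_summable)
  show "ip (ell2 H) (scl (ell2 H) a x) y = a * ip (ell2 H) x y"
    by (simp add: ip_ell2 seq_scl_ell2 ip_scl infsum_cmult_right')
  from has_sum_bounded_linear[OF bounded_linear_conjugate has_sum_infsum[OF ell2_ip_summable]]
  show "ip (ell2 H) y x = conjugate (ip (ell2 H) x y)"
    unfolding ip_ell2 by (intro infsumI) (simp add: ip_conjugate[of "seq y _"])
  have "((\<lambda>i. of_real ((norm (seq x i))\<^sup>2) :: 'f) has_sum of_real ((norm x)\<^sup>2)) UNIV"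
    unfolding norm_ell2_sq by (intro has_sum_of_real has_sum_infsum ell2_sq_summable)
  then show "ip (ell2 H) x x = of_real ((norm x)\<^sup>2)"
    by (simp only: ip_ell2 ip_self infsumI)
qed

lemma ip_ell2_restrict: "ip (ell2 H) (ell2_restrict I f) g = ip (ell2 H) f (ell2_restrict I g)"
  unfolding ip_ell2
  by (intro infsum_cong) (simp add: seq_ell2_restrict ip.zero_left ip.zero_right)

lemma ip_ell2_restrict_right:
  "ip (ell2 H) f (ell2_restrict I g) = (\<Sum>\<^sub>\<infinity>i\<in>I. ip H (seq f i) (seq g i))"
  unfolding ip_ell2
  by (intro infsum_cong_neutral) (auto simp: seq_ell2_restrict ip.zero_right)

lemma ell2_restrict_in_bops: "ell2_restrict I \<in> bops (ell2 H) (ell2 H)"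
  unfolding bops_def by (auto intro!: ell2_eqI simp: seq_ell2_restrict seq_scl_ell2)

end


section \<open>Operator-valued sequences\<close>

locale operator_sequences = hilbert_pair H K
  for H :: "('f::rc_field, 'h::banach) hilbert" and K :: "('f, 'k::real_normed_vector) hilbert"

sublocale operator_sequences \<subseteq> ell2: hilbert_pair H "ell2 K"
  by (intro hilbert_pair.intro X.hilbert_space_axioms Y.pre_hilbert_ell2)

context operator_sequences
begin

lemma analysis_op_in_bops:
  assumes A: "bessel_seq H K I A"
  shows "analysis_op I A \<in> bops H (ell2 K)"
proof -
  have "analysis_op I A (scl H a x) = scl (ell2 K) a (analysis_op I A x)" for a x
    using A by (intro ell2_eqI)
      (simp add: bessel_seq_analysis_op[OF A] Y.seq_scl_ell2, simp add: bessel_seq_def bops_def)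
  then show ?thesis by (simp add: bops_def)
qed

lemma analysis_op_in_ell2_on:
  assumes "bessel_seq H K I A"
  shows "analysis_op I A x \<in> ell2_on I"
  by (simp add: ell2_on_def bessel_seq_analysis_op[OF assms])

lemma norm_sq_analysis_op:
  assumes A: "bessel_seq H K I A"
  shows "(norm (analysis_op I A x))\<^sup>2 = (\<Sum>\<^sub>\<infinity>i\<in>I. (norm (A i x))\<^sup>2)"
  by (simp add: norm_sq_ell2_on[OF analysis_op_in_ell2_on[OF A]] bessel_seq_analysis_op[OF A]
      cong: infsum_cong)

lemma ip_synthesis_op:
  assumes "bessel_seq H K I A"
  shows "ip H x (synthesis_op H K I A f) = ip (ell2 K) (analysis_op I A x) f"
  by (simp add: synthesis_op_def ell2.ip_adj[OF analysis_op_in_bops[OF assms]])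

lemma synthesis_op_in_bops:
  assumes "bessel_seq H K I A"
  shows "synthesis_op H K I A \<in> bops (ell2 K) H"
  unfolding synthesis_op_def by (rule ell2.adj_in_bops[OF analysis_op_in_bops[OF assms]])

lemma synthesis_op_restrict:
  assumes A: "bessel_seq H K I A"
  shows "synthesis_op H K I A (ell2_restrict I f) = synthesis_op H K I A f"
  by (rule X.ip_eqI)
    (simp add: ip_synthesis_op[OF A] ell2_restrict_id[OF analysis_op_in_ell2_on[OF A]]
      flip: Y.ip_ell2_restrict)

lemma synthesis_op_restrict_finite:
  assumes A: "bessel_seq H K I A" and F: "finite F" "F \<subseteq> I"
  shows "synthesis_op H K I A (ell2_restrict F f) = (\<Sum>i\<in>F. adj H K (A i) (seq f i))"
proof (rule X.ip_eqI)
  fix x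
  have "ip H x (synthesis_op H K I A (ell2_restrict F f)) = (\<Sum>i\<in>F. ip K (A i x) (seq f i))"
    using F by (auto simp: ip_synthesis_op[OF A] Y.ip_ell2_restrict_right
        bessel_seq_analysis_op[OF A] intro!: sum.cong)
  also have "\<dots> = (\<Sum>i\<in>F. ip H x (adj H K (A i) (seq f i)))"
    using A F by (intro sum.cong ip_adj) (auto simp: bessel_seq_def)
  finally show "ip H x (synthesis_op H K I A (ell2_restrict F f))
      = ip H x (\<Sum>i\<in>F. adj H K (A i) (seq f i))"
    by (simp add: X.ip.sum_right)
qed

lemma synthesis_op_has_sum:
  assumes A: "bessel_seq H K I A"
  shows "((\<lambda>i. adj H K (A i) (seq f i)) has_sum synthesis_op H K I A f) I"
proof -
  have "((\<lambda>F. synthesis_op H K I A (ell2_restrict F f)) \<longlongrightarrow> synthesis_op H K I A (ell2_restrict I f))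
      (finite_subsets_at_top I)"
    by (intro blinfun.tendsto tendsto_const tendsto_ell2_restrict)
  moreover have "\<forall>\<^sub>F F in finite_subsets_at_top I.
      synthesis_op H K I A (ell2_restrict F f) = (\<Sum>i\<in>F. adj H K (A i) (seq f i))"
    using synthesis_op_restrict_finite[OF A] by (intro eventually_finite_subsets_at_top_weakI)
  ultimately show ?thesis
    unfolding has_sum_def synthesis_op_restrict[OF A] by (simp add: tendsto_cong)
qed

lemma bessel_seq_opseq_of:
  assumes T: "T \<in> bops H (ell2 K)"
  shows "bessel_seq H K I (opseq_of T)"
  unfolding bessel_seq_def
proof (intro conjI exI[of _ "(norm T)\<^sup>2 + 1"] ballI allI)
  show "opseq_of T i \<in> bops H K" for i
    using T by (simp add: bops_def opseq_of_apply Y.seq_scl_ell2)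
  show "0 < (norm T)\<^sup>2 + 1" by (simp add: add_nonneg_pos)
  fix x
  show "(\<lambda>i. (norm (opseq_of T i x))\<^sup>2) summable_on I"
    by (simp add: opseq_of_apply ell2_sq_summable)
  have "(\<Sum>\<^sub>\<infinity>i\<in>I. (norm (opseq_of T i x))\<^sup>2) = (norm (ell2_restrict I (T x)))\<^sup>2"
    by (simp add: norm_sq_ell2_restrict opseq_of_apply)
  also have "\<dots> \<le> (norm T * norm x)\<^sup>2"
    by (intro power_mono order_trans[OF norm_ell2_restrict_le norm_blinfun]) simp
  also have "\<dots> \<le> ((norm T)\<^sup>2 + 1) * (norm x)\<^sup>2"
    by (simp add: power_mult_distrib distrib_right)
  finally show "(\<Sum>\<^sub>\<infinity>i\<in>I. (norm (opseq_of T i x))\<^sup>2) \<le> ((norm T)\<^sup>2 + 1) * (norm x)\<^sup>2" .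
qed

lemma dual_of_iff:
  assumes A: "bessel_seq H K I A"
  shows "dual_of H K I A C \<longleftrightarrow>
    bessel_seq H K I C \<and> synthesis_op H K I A o\<^sub>L analysis_op I C = id_blinfun"
proof (cases "bessel_seq H K I C")
  case C: True
  note TA = analysis_op_in_bops[OF A] and TC = analysis_op_in_bops[OF C]
  have sum: "((\<lambda>i. adj H K (C i) (A i x)) has_sum synthesis_op H K I C (analysis_op I A x)) I" for x
    using synthesis_op_has_sum[OF C, of "analysis_op I A x"]
    by (simp add: bessel_seq_analysis_op[OF A] cong: has_sum_cong)
  have "((\<lambda>i. adj H K (C i) (A i x)) has_sum x) I \<longleftrightarrow>
      synthesis_op H K I C (analysis_op I A x) = x" for x
    using sum[of x] has_sum_unique[OF sum[of x], of x] by auto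
  then have "dual_of H K I A C \<longleftrightarrow> synthesis_op H K I C o\<^sub>L analysis_op I A = id_blinfun"
    by (simp add: dual_of_def C blinfun_compose_eq_id_iff)
  also have "\<dots> \<longleftrightarrow> synthesis_op H K I A o\<^sub>L analysis_op I C = id_blinfun"
    unfolding synthesis_op_def using ell2.adj_compose_eq_id_swap TA TC by blast
  finally show ?thesis using C by simp
qed (simp add: dual_of_def)

lemma op_frame_bounds_imp_bessel_seq:
  "op_frame_bounds H K I A \<alpha> \<beta> \<Longrightarrow> bessel_seq H K I A"
  unfolding op_frame_bounds_def bessel_seq_def by blast

end


section \<open>Operator-valued frames and their duals\<close>

locale operator_frame = operator_sequences +
  fixes I :: "nat set" and A :: "('b, 'c) opseq" and c :: real
  assumes bessel: "bessel_seq H K I A"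
    and c_pos: "0 < c" and below: "c * norm x \<le> norm (analysis_op I A x)"

sublocale operator_frame \<subseteq> T: bounded_below H "ell2 K" "analysis_op I A" c
  by unfold_locales (fact analysis_op_in_bops[OF bessel] c_pos below)+

lemma (in operator_sequences) operator_frame_if_op_frame_bounds:
  assumes A: "op_frame_bounds H K I A \<alpha> \<beta>"
  shows "operator_frame H K I A (sqrt \<alpha>)"
proof unfold_locales
  note bessel = op_frame_bounds_imp_bessel_seq[OF A]
  then show "bessel_seq H K I A" .
  show "0 < sqrt \<alpha>" using A by (simp add: op_frame_bounds_def)
  show "sqrt \<alpha> * norm x \<le> norm (analysis_op I A x)" for x
  proof (rule power2_le_imp_le)
    show "(sqrt \<alpha> * norm x)\<^sup>2 \<le> (norm (analysis_op I A x))\<^sup>2"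
      using A by (simp add: power_mult_distrib norm_sq_analysis_op[OF bessel] op_frame_bounds_def)
  qed simp
qed

context operator_frame
begin

lemma operator_frame_perturbed:
  assumes B: "bessel_seq H K I B" and le: "norm (analysis_op I A - analysis_op I B) \<le> \<mu>"
    and "\<mu> < c"
  shows "operator_frame H K I B (c - \<mu>)"
proof unfold_locales
  fix x
  have "norm (analysis_op I A x - analysis_op I B x) \<le> \<mu> * norm x"
    unfolding blinfun.diff_left[symmetric]
    using norm_blinfun mult_right_mono[OF le norm_ge_zero] by (rule order_trans)
  then show "(c - \<mu>) * norm x \<le> norm (analysis_op I B x)"
    using below[of x] norm_triangle_ineq2[of "analysis_op I A x" "analysis_op I B x"]
    by (simp add: left_diff_distrib)
qed (use assms in simp_all)

lemma synthesis_op_canonical_dual: "synthesis_op H K I A (T.canonical_dual x) = x"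
  unfolding synthesis_op_def by (rule T.adj_canonical_dual)

lemma canonical_dual_in_ell2_on: "T.canonical_dual x \<in> ell2_on I"
  by (simp add: T.canonical_dual_def analysis_op_in_ell2_on[OF bessel])

lemma in_closure_span_range_adj:
  "x \<in> closure (X.span (\<Union>i\<in>I. range (adj H K (A i))))"
proof -
  let ?f = "T.canonical_dual x"
  have "((\<lambda>F. \<Sum>i\<in>F. adj H K (A i) (seq ?f i)) \<longlongrightarrow> x) (finite_subsets_at_top I)"
    using synthesis_op_has_sum[OF bessel, of ?f]
    by (simp add: has_sum_def synthesis_op_canonical_dual)
  moreover have "\<forall>\<^sub>F F in finite_subsets_at_top I.
      (\<Sum>i\<in>F. adj H K (A i) (seq ?f i)) \<in> closure (X.span (\<Union>i\<in>I. range (adj H K (A i))))"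
    by (intro eventually_finite_subsets_at_top_weakI closure_subset[THEN subsetD] X.span_sum
        X.span_base) auto
  ultimately show ?thesis by (intro Lim_in_closed_set[OF closed_closure]) auto
qed

lemma is_op_frame: "op_frame H K I A"
proof -
  obtain \<beta> where "0 < \<beta>" "\<And>x. (\<Sum>\<^sub>\<infinity>i\<in>I. (norm (A i x))\<^sup>2) \<le> \<beta> * (norm x)\<^sup>2"
    and "\<And>i. i \<in> I \<Longrightarrow> A i \<in> bops H K" "\<And>x. (\<lambda>i. (norm (A i x))\<^sup>2) summable_on I"
    using bessel by (auto simp: bessel_seq_def)
  moreover have "c\<^sup>2 * (norm x)\<^sup>2 \<le> (\<Sum>\<^sub>\<infinity>i\<in>I. (norm (A i x))\<^sup>2)" for x
    using power_mono[OF below[of x], of 2] c_pos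
    by (simp add: power_mult_distrib norm_sq_analysis_op[OF bessel])
  ultimately have "op_frame_bounds H K I A (c\<^sup>2) \<beta>"
    unfolding op_frame_bounds_def using c_pos in_closure_span_range_adj by auto
  then show ?thesis unfolding op_frame_def by blast
qed

lemma dual_eq: "dual H K I A L = opseq_of (T.canonical_dual + L)"
  by (simp add: dual_def frame_op_def synthesis_op_def T.canonical_dual_def T.gram_def)

lemma bessel_seq_dual:
  assumes "L \<in> bops H (ell2 K)"
  shows "bessel_seq H K I (dual H K I A L)"
  unfolding dual_eq
  by (intro bessel_seq_opseq_of ell2.Y.bops_add T.canonical_dual_in_bops assms)

lemma analysis_op_dual:
  fixes L :: "'b \<Rightarrow>\<^sub>L 'c ell2"
  assumes "range L \<subseteq> ell2_on I"
  shows "analysis_op I (dual H K I A L) = T.canonical_dual + L"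
  unfolding dual_eq using assms
  by (intro analysis_op_opseq_of)
    (auto simp: blinfun.add_left intro!: ell2_on_add canonical_dual_in_ell2_on)

lemma dual_of_dual:
  assumes L: "L \<in> dual_params H K I A"
  shows "dual_of H K I A (dual H K I A L)"
proof -
  have "synthesis_op H K I A o\<^sub>L T.canonical_dual = id_blinfun"
    by (simp add: blinfun_compose_eq_id_iff synthesis_op_canonical_dual)
  then have "synthesis_op H K I A o\<^sub>L analysis_op I (dual H K I A L) = id_blinfun"
    using L by (simp add: dual_params_def analysis_op_dual blinfun_compose.add_right)
  with L show ?thesis by (simp add: dual_of_iff[OF bessel] bessel_seq_dual dual_params_def)
qed

lemma norm_analysis_op_dual_le:
  assumes "L \<in> dual_params H K I A"
  shows "norm (analysis_op I (dual H K I A L)) \<le> 1 / c + norm L"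
proof -
  have "analysis_op I (dual H K I A L) = T.canonical_dual + L"
    using assms by (intro analysis_op_dual) (simp add: dual_params_def)
  then show ?thesis
    using T.norm_canonical_dual_le norm_triangle_ineq[of T.canonical_dual L] by simp
qed

abbreviation ker_proj :: "'c ell2 \<Rightarrow>\<^sub>L 'c ell2" where
  "ker_proj \<equiv> orth_proj (ell2 K) (synthesis_ker H K I A)"

lemma ker_proj_eq: "ker_proj = ell2_restrict I - (T.canonical_dual o\<^sub>L synthesis_op H K I A)"
proof (rule ell2.Y.orth_proj_eqI)
  let ?P = "ell2_restrict I - (T.canonical_dual o\<^sub>L synthesis_op H K I A)"
  show "u - v \<in> synthesis_ker H K I A"
    if "u \<in> synthesis_ker H K I A" "v \<in> synthesis_ker H K I A" for u v
    using that by (simp add: synthesis_ker_def ell2_on_diff blinfun.diff_right)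
  show "?P f \<in> synthesis_ker H K I A" for f
    by (simp add: synthesis_ker_def ell2_on_diff ell2_restrict_in_ell2_on canonical_dual_in_ell2_on
        blinfun.diff_left blinfun.diff_right synthesis_op_canonical_dual
        synthesis_op_restrict[OF bessel])
  show "ip (ell2 K) (f - ?P f) v = 0" if "v \<in> synthesis_ker H K I A" for f v
    using that
    by (simp add: synthesis_ker_def blinfun.diff_left ell2.Y.ip.add_left ell2.Y.ip.diff_left
        Y.ip_ell2_restrict ell2_restrict_id T.ip_canonical_dual_adj X.ip.zero_right
        flip: synthesis_op_def)
qed

lemma ker_proj_compose_in_dual_params:
  assumes "U \<in> bops H (ell2 K)"
  shows "ker_proj o\<^sub>L U \<in> dual_params H K I A"
proof -
  have "ker_proj o\<^sub>L U \<in> bops H (ell2 K)"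
    unfolding ker_proj_eq
    by (intro bops_compose[OF ell2.Y.bops_diff assms] Y.ell2_restrict_in_bops
        bops_compose[OF T.canonical_dual_in_bops] synthesis_op_in_bops bessel)
  moreover have "range (ker_proj o\<^sub>L U) \<subseteq> ell2_on I"
    by (auto simp: ker_proj_eq blinfun.diff_left
        intro!: ell2_on_diff ell2_restrict_in_ell2_on canonical_dual_in_ell2_on)
  moreover have "synthesis_op H K I A o\<^sub>L (ker_proj o\<^sub>L U) = 0"
    by (intro blinfun_eqI) (simp add: ker_proj_eq blinfun.diff_left blinfun.diff_right
        synthesis_op_restrict[OF bessel] synthesis_op_canonical_dual)
  ultimately show ?thesis by (simp add: dual_params_def)
qed

abbreviation nearest_dual :: "('b, 'c) opseq \<Rightarrow> ('b, 'c) opseq" where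
  "nearest_dual C \<equiv> dual H K I A (ker_proj o\<^sub>L analysis_op I C)"

lemma dual_of_nearest_dual:
  assumes "bessel_seq H K I C"
  shows "dual_of H K I A (nearest_dual C)"
  by (intro dual_of_dual ker_proj_compose_in_dual_params analysis_op_in_bops assms)

lemma analysis_op_nearest_dual_diff:
  assumes C: "bessel_seq H K I C"
  shows "analysis_op I (nearest_dual C) - analysis_op I C
    = T.canonical_dual o\<^sub>L (id_blinfun - (synthesis_op H K I A o\<^sub>L analysis_op I C))"
proof -
  have "range (ker_proj o\<^sub>L analysis_op I C) \<subseteq> ell2_on I"
    using ker_proj_compose_in_dual_params[OF analysis_op_in_bops[OF C]]
    by (simp add: dual_params_def)
  then show ?thesis
    by (intro blinfun_eqI) (simp add: analysis_op_dual ker_proj_eq blinfun.add_left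
        blinfun.diff_left blinfun.diff_right ell2_restrict_id[OF analysis_op_in_ell2_on[OF C]])
qed

lemma nearest_dual_is_nearest:
  assumes C: "bessel_seq H K I C" and D: "dual_of H K I A D"
  shows "norm (analysis_op I (nearest_dual C) - analysis_op I C)
    \<le> norm (analysis_op I D - analysis_op I C)"
proof -
  let ?Q = "T.canonical_dual o\<^sub>L synthesis_op H K I A"
  have "synthesis_op H K I A (analysis_op I D x) = x" for x
    using D by (simp add: dual_of_iff[OF bessel] blinfun_compose_eq_id_iff)
  then have "analysis_op I (nearest_dual C) - analysis_op I C
      = ?Q o\<^sub>L (analysis_op I D - analysis_op I C)"
    unfolding analysis_op_nearest_dual_diff[OF C]
    by (intro blinfun_eqI) (simp add: blinfun.diff_left blinfun.diff_right)
  also have "norm \<dots> \<le> norm ?Q * norm (analysis_op I D - analysis_op I C)"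
    by (rule norm_blinfun_compose)
  also have "\<dots> \<le> 1 * norm (analysis_op I D - analysis_op I C)"
    unfolding synthesis_op_def by (intro mult_right_mono T.norm_canonical_dual_adj_le norm_ge_zero)
  finally show ?thesis by simp
qed

lemma norm_nearest_dual_diff_le:
  assumes B: "bessel_seq H K I B" and C: "dual_of H K I B C"
  shows "norm (analysis_op I (nearest_dual C) - analysis_op I C)
    \<le> norm (analysis_op I B - analysis_op I A) / c * norm (analysis_op I C)"
proof -
  let ?\<Delta> = "analysis_op I B - analysis_op I A"
  note TA = analysis_op_in_bops[OF bessel] and TB = analysis_op_in_bops[OF B]
  have bessel_C: "bessel_seq H K I C" using C by (simp add: dual_of_def)
  have "id_blinfun = synthesis_op H K I B o\<^sub>L analysis_op I C"
    using C by (simp add: dual_of_iff[OF B])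
  then have "analysis_op I (nearest_dual C) - analysis_op I C
      = T.canonical_dual o\<^sub>L (adj H (ell2 K) ?\<Delta> o\<^sub>L analysis_op I C)"
    unfolding analysis_op_nearest_dual_diff[OF bessel_C] synthesis_op_def ell2.adj_diff[OF TB TA]
    by (simp add: blinfun_compose.diff_left)
  also have "norm \<dots> \<le> norm T.canonical_dual * (norm (adj H (ell2 K) ?\<Delta>) * norm (analysis_op I C))"
    by (intro order_trans[OF norm_blinfun_compose] mult_left_mono norm_blinfun_compose norm_ge_zero)
  also have "\<dots> \<le> 1 / c * (norm ?\<Delta> * norm (analysis_op I C))"
    using c_pos by (intro mult_mono mult_right_mono T.norm_canonical_dual_le ell2.norm_adj_le
        ell2.Y.bops_diff TA TB) simp_all
  finally show ?thesis by simp
qed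

lemma perturbation_nearest_dual:
  assumes B: "perturbation H K I \<mu> B A" and C: "dual_of H K I B C"
    and le: "norm (analysis_op I C) \<le> r" and "0 < r"
  shows "perturbation H K I (\<mu> / c * r) C (nearest_dual C)"
proof -
  have bessel_C: "bessel_seq H K I C" using C by (simp add: dual_of_def)
  have "norm (analysis_op I (nearest_dual C) - analysis_op I C)
      \<le> norm (analysis_op I B - analysis_op I A) / c * norm (analysis_op I C)"
    using B by (intro norm_nearest_dual_diff_le C) (simp add: perturbation_def)
  also have "\<dots> \<le> \<mu> / c * r"
    using B c_pos le by (intro mult_mono divide_right_mono) (simp_all add: perturbation_def)
  finally show ?thesis
    using B c_pos \<open>0 < r\<close> bessel_C dual_of_nearest_dual[OF bessel_C]
    by (simp add: perturbation_def dual_of_def norm_minus_commute)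
qed

end

theorem theorem4p13:
  fixes H :: "('f::rc_field, 'h::banach) hilbert"
    and K :: "('f, 'k::banach) hilbert"
    and I :: "nat set"
    and A B :: "('h, 'k) opseq"
    and \<alpha> \<beta> \<mu> :: real
  assumes "hilbert_space H" and "hilbert_space K"
    and "op_frame_bounds H K I A \<alpha> \<beta>"
    and "0 < \<mu>" and "\<mu> < sqrt \<alpha>"
    and "perturbation H K I \<mu> A B"
  shows "op_frame H K I B \<and>
    (\<forall>L \<in> dual_params H K I A.
       let AL = dual H K I A L;
           M = orth_proj (ell2 K) (synthesis_ker H K I B) o\<^sub>L analysis_op I AL;
           BL = dual H K I B M
       in M \<in> dual_params H K I B \<and>
          dual_of H K I B BL \<and>
          (\<forall>C. dual_of H K I B C \<longrightarrow>
             norm (analysis_op I BL - analysis_op I AL) \<le> norm (analysis_op I C - analysis_op I AL)) \<and>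
          perturbation H K I (\<mu> / (sqrt \<alpha> - \<mu>) * (1 / sqrt \<alpha> + norm L)) AL BL)"
proof -
  interpret operator_sequences H K
    using assms(1,2) by (intro operator_sequences.intro hilbert_pair.intro
        hilbert_space.is_pre_hilbert)
  interpret A: operator_frame H K I A "sqrt \<alpha>"
    by (rule operator_frame_if_op_frame_bounds[OF assms(3)])
  interpret B: operator_frame H K I B "sqrt \<alpha> - \<mu>"
    using assms(5,6) by (intro A.operator_frame_perturbed) (simp_all add: perturbation_def)
  show ?thesis
    unfolding Let_def
  proof (intro conjI ballI allI impI)
    fix L assume L: "L \<in> dual_params H K I A"
    let ?C = "dual H K I A L"
    have C: "dual_of H K I A ?C" by (rule A.dual_of_dual[OF L])
    then have bessel_C: "bessel_seq H K I ?C" by (simp add: dual_of_def)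
    then show "B.ker_proj o\<^sub>L analysis_op I ?C \<in> dual_params H K I B"
      by (intro B.ker_proj_compose_in_dual_params analysis_op_in_bops)
    show "dual_of H K I B (B.nearest_dual ?C)" by (rule B.dual_of_nearest_dual[OF bessel_C])
    show "norm (analysis_op I (B.nearest_dual ?C) - analysis_op I ?C)
        \<le> norm (analysis_op I D - analysis_op I ?C)" if "dual_of H K I B D" for D
      by (rule B.nearest_dual_is_nearest[OF bessel_C that])
    show "perturbation H K I (\<mu> / (sqrt \<alpha> - \<mu>) * (1 / sqrt \<alpha> + norm L)) ?C (B.nearest_dual ?C)"
      using A.c_pos A.norm_analysis_op_dual_le[OF L]
      by (intro B.perturbation_nearest_dual[OF assms(6) C]) (simp_all add: add_pos_nonneg)
  qed (rule B.is_op_frame)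
qed

end
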